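(* Let $K$ be a first-countable compact Hausdorff space. Suppose that for every continuous interval $[f,g]$ in $C(K)$ the product $[f,g]\cdot[f,g]$ is convex. Then $K$ is finite.
   Context: $C(K)$ is the Banach algebra of continuous real functions on $K$ with the supremum norm. For $A,B\subset C(K)$, $A\cdot B=\{ab: a\in A,\ b\in B\}$ with pointwise products. An interval in $C(K)$ is a set of the form $[f,g]=\{h\in C(K): f\le h\le g\}$, where $f,g:K\to\mathbb{R}$ are bounded functions (not necessarily continuous) and inequalities between functions are pointwise; such a pair $f,g$ is called a representation of the interval. An interval is continuous if it has a representation $[f,g]$ with $f,g$ continuous. *)

theory Defs
  imports "HOL-Analysis.Analysis"
begin

(* C(K) is the library type of bounded continuous functions 'k \<Rightarrow>\<^sub>C real, where K is the
   whole type 'k. On a compact space every continuous real function is bounded, so this is all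
   of C(K). The library gives it its vector space structure and the supremum metric, but no
   multiplication. *)

definition pointwise_mult ::
    "('k::topological_space \<Rightarrow>\<^sub>C real) \<Rightarrow> ('k \<Rightarrow>\<^sub>C real) \<Rightarrow> ('k \<Rightarrow>\<^sub>C real)" where
  "pointwise_mult a b = Bcontfun (\<lambda>x. apply_bcontfun a x * apply_bcontfun b x)"

lemma apply_bcontfun_pointwise_mult [simp]:
  "apply_bcontfun (pointwise_mult a b) x = apply_bcontfun a x * apply_bcontfun b x"
proof -
  obtain M where M: "\<And>y. norm (apply_bcontfun a y) \<le> M"
    using bounded_apply_bcontfun[of a] by (force simp: bounded_iff)
  obtain N where N: "\<And>y. norm (apply_bcontfun b y) \<le> N"
    using bounded_apply_bcontfun[of b] by (force simp: bounded_iff)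
  have "norm (apply_bcontfun a y * apply_bcontfun b y) \<le> M * N" for y
    unfolding norm_mult using M[of y] N[of y]
    by (intro mult_mono) (auto intro: order_trans[OF norm_ge_zero])
  moreover have "continuous_on UNIV (\<lambda>y. apply_bcontfun a y * apply_bcontfun b y)"
    by (intro continuous_on_mult continuous_on_apply_bcontfun continuous_on_id)
  ultimately have "(\<lambda>y. apply_bcontfun a y * apply_bcontfun b y) \<in> bcontfun"
    by (intro bcontfun_normI)
  then show ?thesis
    by (simp add: pointwise_mult_def Bcontfun_inverse)
qed

definition set_product ::
    "('k::topological_space \<Rightarrow>\<^sub>C real) set \<Rightarrow> ('k \<Rightarrow>\<^sub>C real) set \<Rightarrow> ('k \<Rightarrow>\<^sub>C real) set" where
  "set_product A B = {pointwise_mult a b | a b. a \<in> A \<and> b \<in> B}"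

definition fun_interval ::
    "('k::topological_space \<Rightarrow> real) \<Rightarrow> ('k \<Rightarrow> real) \<Rightarrow> ('k \<Rightarrow>\<^sub>C real) set" where
  "fun_interval f g = {h. \<forall>x. f x \<le> apply_bcontfun h x \<and> apply_bcontfun h x \<le> g x}"

(* The bounding functions need not be continuous. *)
definition represents ::
    "('k::topological_space \<Rightarrow> real) \<Rightarrow> ('k \<Rightarrow> real) \<Rightarrow> ('k \<Rightarrow>\<^sub>C real) set \<Rightarrow> bool" where
  "represents f g I \<longleftrightarrow> bounded (range f) \<and> bounded (range g) \<and> I = fun_interval f g"

definition continuous_interval :: "('k::topological_space \<Rightarrow>\<^sub>C real) set \<Rightarrow> bool" where
  "continuous_interval I \<longleftrightarrow>
     (\<exists>f g. represents f g I \<and> continuous_on UNIV f \<and> continuous_on UNIV g)"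

end

(* Take a limit point p of K and a continuous phi that takes both signs in every neighbourhood of p.
   On the interval from f = -1 - max(-phi, 0) to g = 1 + max(phi, 0), the midpoint of f^2 and g^2
   exceeds 1 at every x where phi x is nonzero. If it is a product a b, then a and b are both positive
   where phi > 0, since f = -1 there, and both negative where phi < 0, since g = 1 there.
   By continuity a p = 0, while a p * b p = 1.
   To get phi, first countability yields a continuous psi that vanishes only at p and points x n
   tending to p with psi (x n) strictly decreasing. Then phi is the difference of the distances
   of psi x to the closures of the even-indexed and of the odd-indexed values. *)
theory Submission
  imports Defs
begin

lemma compact_UNIV_continuous_on_bcontfun:
  fixes u :: "'k::topological_space \<Rightarrow> 'b::metric_space"
  assumes "compact (UNIV :: 'k set)" "continuous_on UNIV u"
  shows "u \<in> bcontfun"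
  using assms by (simp add: bcontfun_def compact_continuous_image compact_imp_bounded)

text \<open>If \<open>a\<close> were nonpositive, \<open>- a\<close> would lie in the unit interval
  while \<open>- b\<close> is at most 1, so the product \<open>a * b = (- a) * (- b)\<close> could
  not exceed 1.\<close>

lemma mult_gt_one_imp_pos:
  fixes a b :: real
  assumes "a * b > 1" "a \<ge> -1" "b \<ge> -1"
  shows "a > 0"
proof (rule ccontr)
  assume "\<not> a > 0"
  then have "0 \<le> - a" by simp
  then have "- a * - b \<le> - a * 1"
    using assms(3) by (intro mult_left_mono) auto
  then show False using assms by simp
qed

lemma not_convex_set_product:
  fixes \<phi> :: "'k::topological_space \<Rightarrow> real"
  assumes K: "compact (UNIV :: 'k set)" and \<phi>: "continuous_on UNIV \<phi>"
    and x: "x \<longlonglongrightarrow> p" "\<And>n :: nat. \<phi> (x n) > 0"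
    and y: "y \<longlonglongrightarrow> p" "\<And>n :: nat. \<phi> (y n) < 0"
  shows "\<exists>I :: ('k \<Rightarrow>\<^sub>C real) set. continuous_interval I \<and> \<not> convex (set_product I I)"
proof -
  define F where "F z = - 1 - max (- \<phi> z) 0" for z
  define G where "G z = 1 + max (\<phi> z) 0" for z
  have cF: "continuous_on UNIV F" and cG: "continuous_on UNIV G"
    unfolding F_def G_def by (intro continuous_intros \<phi>)+
  have bF: "F \<in> bcontfun" and bG: "G \<in> bcontfun"
    using K cF cG by (auto intro: compact_UNIV_continuous_on_bcontfun)
  \<comment> \<open>The endpoints are continuous, so they belong to the interval themselves and
    their squares belong to the product set.\<close>
  obtain f where f: "apply_bcontfun f = F" using bF Bcontfun_inverse by blast
  obtain g where g: "apply_bcontfun g = G" using bG Bcontfun_inverse by blast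
  let ?I = "fun_interval F G"
  have I: "continuous_interval ?I"
    unfolding continuous_interval_def represents_def
    using cF cG bF bG by (auto simp: bcontfun_def)
  have lim: "(\<lambda>n. u (z n)) \<longlonglongrightarrow> u p" if "continuous_on UNIV u" "z \<longlonglongrightarrow> p" for u :: "'k \<Rightarrow> real" and z
    using continuous_on_tendsto_compose[OF that] by simp
  \<comment> \<open>The two sequences squeeze \<open>\<phi> p\<close> from both sides. Hence
    \<open>F p = -1\<close> and \<open>G p = 1\<close>, and both squares are 1 at
    \<open>p\<close>.\<close>
  have "\<phi> p \<ge> 0"
    by (rule LIMSEQ_le_const[OF lim[OF \<phi> x(1)]]) (auto intro: less_imp_le x)
  moreover have "\<phi> p \<le> 0"
    by (rule LIMSEQ_le_const2[OF lim[OF \<phi> y(1)]]) (auto intro: less_imp_le y)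
  ultimately have \<phi>p: "\<phi> p = 0" by simp
  have "\<not> convex (set_product ?I ?I)"
  proof
    assume conv: "convex (set_product ?I ?I)"
    have le: "F z \<le> G z" for z by (auto simp: F_def G_def)
    have "f \<in> ?I" "g \<in> ?I" using f g le by (auto simp: fun_interval_def)
    then have "pointwise_mult f f \<in> set_product ?I ?I" "pointwise_mult g g \<in> set_product ?I ?I"
      by (auto simp: set_product_def)
    then have "(1/2) *\<^sub>R pointwise_mult f f + (1/2) *\<^sub>R pointwise_mult g g \<in> set_product ?I ?I"
      by (intro convexD[OF conv]) auto
    then obtain a b where a: "a \<in> ?I" and b: "b \<in> ?I"
      and ab: "(1/2) *\<^sub>R pointwise_mult f f + (1/2) *\<^sub>R pointwise_mult g g = pointwise_mult a b"
      by (auto simp: set_product_def)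
    have eq: "apply_bcontfun a z * apply_bcontfun b z = (F z * F z + G z * G z) / 2" for z
      using arg_cong[OF ab, of "\<lambda>h. apply_bcontfun h z"]
      by (simp add: f g)
    have "apply_bcontfun a p * apply_bcontfun b p = 1"
      unfolding eq by (simp add: F_def G_def \<phi>p)
    moreover have gt: "apply_bcontfun a z * apply_bcontfun b z > 1" if "\<phi> z \<noteq> 0" for z
    proof -
      \<comment> \<open>Whichever sign \<open>\<phi> z\<close> has, one of \<open>F z\<close>,
        \<open>G z\<close> has absolute value \<open>1 + \<bar>\<phi> z\<bar>\<close> and the other
        has absolute value 1.\<close>
      have "1 < (1 + \<bar>\<phi> z\<bar>) * (1 + \<bar>\<phi> z\<bar>)" using that by (intro less_1_mult) auto
      moreover have "F z * F z + G z * G z = (1 + \<bar>\<phi> z\<bar>) * (1 + \<bar>\<phi> z\<bar>) + 1"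
        by (cases "\<phi> z \<ge> 0") (auto simp: F_def G_def max_def algebra_simps)
      ultimately show ?thesis unfolding eq by simp
    qed
    have bounds: "F z \<le> apply_bcontfun a z" "F z \<le> apply_bcontfun b z"
        "apply_bcontfun a z \<le> G z" "apply_bcontfun b z \<le> G z" for z
      using a b by (auto simp: fun_interval_def)
    have "apply_bcontfun a (x n) > 0" for n
      using gt[of "x n"] bounds[of "x n"] x(2)[of n]
      by (intro mult_gt_one_imp_pos[of _ "apply_bcontfun b (x n)"]) (auto simp: F_def)
    then have "apply_bcontfun a p \<ge> 0"
      by (intro LIMSEQ_le_const[OF lim[OF _ x(1)]]) (auto intro: less_imp_le)
    \<comment> \<open>Here \<open>G (y n) = 1\<close>, so the negated factors are at least -1 and
      have the same product.\<close>
    moreover have "- apply_bcontfun a (y n) > 0" for n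
      using gt[of "y n"] bounds[of "y n"] y(2)[of n]
      by (intro mult_gt_one_imp_pos[of _ "- apply_bcontfun b (y n)"]) (auto simp: G_def)
    then have "apply_bcontfun a p \<le> 0"
      by (intro LIMSEQ_le_const2[OF lim[OF _ y(1)]]) (auto intro: less_imp_le)
    ultimately show False by auto
  qed
  with I show ?thesis by blast
qed

text \<open>Urysohn functions that vanish at \<open>p\<close> and equal 1 off the n-th set of a
  countable neighbourhood base are summed with weights \<open>(1/2)^n\<close>. The weights make the
  convergence uniform, hence the sum continuous.\<close>

lemma continuous_zero_exactly_at_point:
  fixes p :: "'k::{first_countable_topology, t2_space}"
  assumes K: "compact (UNIV :: 'k set)"
  obtains \<psi> :: "'k \<Rightarrow> real"
    where "continuous_on UNIV \<psi>" "\<psi> p = 0" "\<And>z. z \<noteq> p \<Longrightarrow> \<psi> z > 0"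
proof -
  obtain A :: "nat \<Rightarrow> 'k set" where A: "\<And>i. open (A i)" "\<And>i. p \<in> A i"
    "\<And>S. open S \<Longrightarrow> p \<in> S \<Longrightarrow> eventually (\<lambda>i. A i \<subseteq> S) sequentially"
    using countable_basis_at_decseq[of p] by blast
  have normal: "normal_space (euclidean :: 'k topology)"
  proof (rule compact_Hausdorff_or_regular_imp_normal_space)
    show "compact_space (euclidean :: 'k topology)"
      using K by (simp add: compact_space_def)
    have "Hausdorff_space (euclidean :: 'k topology)"
      by (simp add: Hausdorff_space_def disjnt_def) (meson hausdorff)
    then show "Hausdorff_space (euclidean :: 'k topology) \<or> regular_space (euclidean :: 'k topology)" ..
  qed
  have "\<exists>h :: 'k \<Rightarrow> real. continuous_on UNIV h \<and> h p = 0 \<and> (\<forall>z. 0 \<le> h z \<and> h z \<le> 1) \<and>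
      (\<forall>z. z \<notin> A n \<longrightarrow> h z = 1)" for n
  proof -
    have "closedin euclidean {p}" "closedin euclidean (- A n)" "disjnt {p} (- A n)"
      using A by (auto simp: disjnt_def)
    then obtain h where "continuous_map euclidean (top_of_set {0..1::real}) h"
      "h ` {p} \<subseteq> {0}" "h ` (- A n) \<subseteq> {1}"
      using Urysohn_lemma[OF normal, of "{p}" "- A n" 0 1] by auto
    then show ?thesis
      by (intro exI[of _ h]) (auto simp: continuous_map_in_subtopology)
  qed
  then obtain h :: "nat \<Rightarrow> 'k \<Rightarrow> real" where h: "\<And>n. continuous_on UNIV (h n)" "\<And>n. h n p = 0"
    "\<And>n z. 0 \<le> h n z" "\<And>n z. h n z \<le> 1" "\<And>n z. z \<notin> A n \<Longrightarrow> h n z = 1"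
    by metis
  define \<psi> where "\<psi> z = (\<Sum>n. (1/2)^n * h n z)" for z
  have bound: "norm ((1/2)^n * h n z) \<le> (1/2)^n" for n z
    using h(3,4)[of n z] by (simp add: abs_mult mult_left_le)
  have sm: "summable (\<lambda>n. (1/2)^n * h n z)" for z
    by (rule summable_comparison_test'[OF summable_geometric[of "1/2::real"]]) (use bound in auto)
  have "uniform_limit UNIV (\<lambda>n z. \<Sum>i<n. (1/2)^i * h i z) \<psi> sequentially"
    unfolding \<psi>_def by (rule Weierstrass_m_test[OF bound]) (auto intro: summable_geometric)
  then have "continuous_on UNIV \<psi>"
    by (rule uniform_limit_theorem[rotated])
      (auto intro!: always_eventually continuous_intros h(1))
  moreover have "\<psi> p = 0" by (simp add: \<psi>_def h(2))
  moreover have "\<psi> z > 0" if "z \<noteq> p" for z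
  proof -
    \<comment> \<open>Points are closed, so some base set misses \<open>z\<close>. The term of that
      index is positive at \<open>z\<close>, and no term is negative.\<close>
    have "\<exists>i. A i \<subseteq> - {z}"
      using A(3)[of "- {z}"] that by (auto simp: eventually_sequentially open_Compl)
    then obtain i where "z \<notin> A i" by auto
    then show ?thesis
      unfolding \<psi>_def using h(3) h(5)[of z i] by (intro suminf_pos2[OF sm, of z i]) auto
  qed
  ultimately show ?thesis using that by blast
qed

lemma islimpt_obtain_both_signs:
  fixes p :: "'k::{first_countable_topology, t2_space}"
  assumes K: "compact (UNIV :: 'k set)" and p: "p islimpt UNIV"
  obtains \<phi> :: "'k \<Rightarrow> real" and x y :: "nat \<Rightarrow> 'k"
    where "continuous_on UNIV \<phi>" "x \<longlonglongrightarrow> p" "\<And>n. \<phi> (x n) > 0" "y \<longlonglongrightarrow> p" "\<And>n. \<phi> (y n) < 0"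
proof -
  obtain \<psi> :: "'k \<Rightarrow> real" where \<psi>: "continuous_on UNIV \<psi>" "\<psi> p = 0" "\<And>z. z \<noteq> p \<Longrightarrow> \<psi> z > 0"
    using continuous_zero_exactly_at_point[OF K] by blast
  obtain A :: "nat \<Rightarrow> 'k set" where A: "\<And>i. open (A i)" "\<And>i. p \<in> A i"
    "\<And>S. open S \<Longrightarrow> p \<in> S \<Longrightarrow> eventually (\<lambda>i. A i \<subseteq> S) sequentially"
    using countable_basis_at_decseq[of p] by blast
  have "\<exists>w. \<forall>n. (w n \<in> A n \<and> w n \<noteq> p) \<and> \<psi> (w (Suc n)) < \<psi> (w n)"
  proof (intro dependent_nat_choice)
    show "\<exists>z. z \<in> A 0 \<and> z \<noteq> p" using islimptE[OF p A(2) A(1)] by blast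
  next
    \<comment> \<open>Since \<open>\<psi> p = 0 < \<psi> z\<close>, requiring a smaller value of
      \<open>\<psi>\<close> still leaves an open neighbourhood of \<open>p\<close>, which contains a
      point other than \<open>p\<close>.\<close>
    fix z n assume "z \<in> A n \<and> z \<noteq> p"
    then have "p \<in> A (Suc n) \<inter> {v. \<psi> v < \<psi> z}" using A \<psi> by auto
    moreover have "open (A (Suc n) \<inter> {v. \<psi> v < \<psi> z})"
      using A \<psi>(1) by (intro open_Int open_Collect_less) auto
    ultimately obtain v where "v \<in> A (Suc n) \<inter> {v. \<psi> v < \<psi> z}" "v \<noteq> p"
      by (rule islimptE[OF p])
    then show "\<exists>v. (v \<in> A (Suc n) \<and> v \<noteq> p) \<and> \<psi> v < \<psi> z" by blast
  qed
  then obtain w where w: "\<And>n. w n \<in> A n" "\<And>n. w n \<noteq> p" "\<And>n. \<psi> (w (Suc n)) < \<psi> (w n)"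
    by blast
  have "w \<longlonglongrightarrow> p"
  proof (rule topological_tendstoI)
    fix S assume "open S" "p \<in> S"
    from A(3)[OF this] show "eventually (\<lambda>n. w n \<in> S) sequentially"
      by eventually_elim (use w(1) in auto)
  qed
  then have we: "(\<lambda>n. w (2 * n)) \<longlonglongrightarrow> p" and wo: "(\<lambda>n. w (2 * n + 1)) \<longlonglongrightarrow> p"
    using LIMSEQ_subseq_LIMSEQ[of w p "\<lambda>n. 2 * n"] LIMSEQ_subseq_LIMSEQ[of w p "\<lambda>n. 2 * n + 1"]
    by (auto simp: strict_mono_def o_def)
  \<comment> \<open>Injectivity keeps the even-indexed values apart from the odd-indexed ones. As
    all of them are positive, \<open>E\<close> and \<open>D\<close> below share only 0.\<close>
  have inj: "inj (\<lambda>n. \<psi> (w n))"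
  proof -
    have "strict_mono (\<lambda>n. - \<psi> (w n))" using w(3) by (simp add: strict_mono_Suc_iff)
    from strict_mono_imp_inj_on[OF this, of UNIV] show ?thesis by (simp add: inj_on_def)
  qed
  \<comment> \<open>Adding the limit \<open>\<psi> p = 0\<close> makes each set of values compact,
    hence closed, so a point outside it has positive distance to it.\<close>
  define E where "E = insert 0 (range (\<lambda>n. \<psi> (w (2 * n))))"
  define D where "D = insert 0 (range (\<lambda>n. \<psi> (w (2 * n + 1))))"
  have "closed E" "closed D"
    unfolding E_def D_def
    using continuous_on_tendsto_compose[OF \<psi>(1) we] continuous_on_tendsto_compose[OF \<psi>(1) wo]
    by (auto simp: \<psi>(2) intro!: compact_imp_closed compact_sequence_with_limit)
  moreover have "2 * m \<noteq> 2 * n + 1" for m n :: nat by presburger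
  then have "\<psi> (w (2 * m)) \<notin> D" "\<psi> (w (2 * n + 1)) \<notin> E" for m n
    using \<psi>(3)[OF w(2), THEN less_imp_neq] unfolding E_def D_def
    by (auto dest!: injD[OF inj] dest: sym)
  moreover have "\<psi> (w (2 * n)) \<in> E" "\<psi> (w (2 * n + 1)) \<in> D" for n
    by (auto simp: E_def D_def)
  moreover have "E \<noteq> {}" "D \<noteq> {}" by (auto simp: E_def D_def)
  ultimately have pos: "infdist (\<psi> (w (2 * n))) D > 0" "infdist (\<psi> (w (2 * n + 1))) E > 0"
    and zero: "infdist (\<psi> (w (2 * n))) E = 0" "infdist (\<psi> (w (2 * n + 1))) D = 0" for n
    by (auto intro!: infdist_pos_not_in_closed)
  \<comment> \<open>An even-indexed value has distance 0 to \<open>E\<close> and positive distance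
    to \<open>D\<close>; for odd indices the roles are exchanged. This gives the difference its two
    signs.\<close>
  show ?thesis
  proof (rule that[OF _ we _ wo])
    show "continuous_on UNIV (\<lambda>z. infdist (\<psi> z) D - infdist (\<psi> z) E)"
      by (intro continuous_intros \<psi>(1))
  qed (use pos zero in simp_all)
qed

theorem theorem4p4:
  assumes "compact (UNIV :: 'k::{first_countable_topology, t2_space} set)"
    and "\<And>I :: ('k \<Rightarrow>\<^sub>C real) set. continuous_interval I \<Longrightarrow> convex (set_product I I)"
  shows "finite (UNIV :: 'k set)"
proof (rule ccontr)
  assume "infinite (UNIV :: 'k set)"
  then obtain p :: 'k where "p islimpt UNIV"
    using Heine_Borel_imp_Bolzano_Weierstrass[OF assms(1)] by blast
  then show False
  proof (rule islimpt_obtain_both_signs[OF assms(1)])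
    fix \<phi> :: "'k \<Rightarrow> real" and x y :: "nat \<Rightarrow> 'k"
    assume "continuous_on UNIV \<phi>" "x \<longlonglongrightarrow> p" "\<And>n. \<phi> (x n) > 0" "y \<longlonglongrightarrow> p" "\<And>n. \<phi> (y n) < 0"
    from not_convex_set_product[OF assms(1) this] show False using assms(2) by blast
  qed
qed

end
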